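(* Let $\Re k>0$, and let $f(x)$ be a function analytic in an open neighborhood of the strip $|\Re x|\le 1$. Provided that the integrals in the formula below are well defined, $$\Psi_k(f)=(1-q^{k+1})\,\Psi_{k+1}(f)+q^{k+3/2}\,\Psi_{k+2}(S^2(f)).$$
   Context: Here $0<q<1$, $q=e^{-1/a}$ with real $a>0$, and $q^z=e^{-z/a}$ for $z\in\mathbb C$. For complex $k$, $$\delta_k(x)=\prod_{j=0}^\infty \frac{(1-q^{2x+j})(1-q^{-2x+j})}{(1-q^{2x+j+k})(1-q^{-2x+j+k})},\qquad g_k=\prod_{j=0}^\infty\frac{1-q^{k+j}}{1-q^{2k+j}}.$$ The $q$-Mellin transform of a function $f$ on the imaginary line is $$\Psi_k(f)=\frac{1}{i\,g_k}\int_{i\mathbb R} f(x)\,\delta_k(x)\,dx\qquad(\Re k>0).$$ The shift operator is $$S(f)(x)=\frac{f(x-\frac12)-f(x+\frac12)}{q^x-q^{-x}}.$$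
   Formalization: Besides convergence of the three integrals, the formal theorem assumes that the integral of |f| over the segments |Re x|≤1, Im x=y becomes arbitrarily small for some y→+∞ and some y→−∞; convergence alone does not suffice for the identity. *)

theory Defs
  imports "HOL-Complex_Analysis.Complex_Analysis"
begin

text \<open>Throughout, \<open>a > 0\<close> is real and \<open>q = exp (- 1 / a)\<close>; \<open>qpow a z\<close> is \<open>q\<close> to the power \<open>z\<close>.\<close>

definition qpow :: "real \<Rightarrow> complex \<Rightarrow> complex" where
  "qpow a z = exp (- z / of_real a)"

definition delta :: "real \<Rightarrow> complex \<Rightarrow> complex \<Rightarrow> complex" where
  "delta a k x =
     (\<Prod>j. ((1 - qpow a (2 * x + of_nat j)) * (1 - qpow a (- 2 * x + of_nat j))) /
           ((1 - qpow a (2 * x + of_nat j + k)) * (1 - qpow a (- 2 * x + of_nat j + k))))"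

definition g_norm :: "real \<Rightarrow> complex \<Rightarrow> complex" where
  "g_norm a k = (\<Prod>j. (1 - qpow a (k + of_nat j)) / (1 - qpow a (2 * k + of_nat j)))"

text \<open>
  Integrals over the imaginary line, parametrised by \<open>x = \<i> * t\<close>. The Henstock--Kurzweil
  integral over \<open>UNIV\<close> covers absolutely convergent as well as conditionally convergent
  improper integrals.
\<close>

definition imag_line_integrable :: "(complex \<Rightarrow> complex) \<Rightarrow> bool" where
  "imag_line_integrable h \<longleftrightarrow> (\<lambda>t::real. h (\<i> * of_real t)) integrable_on UNIV"

definition imag_line_integral :: "(complex \<Rightarrow> complex) \<Rightarrow> complex" where
  "imag_line_integral h = \<i> * integral UNIV (\<lambda>t::real. h (\<i> * of_real t))"

definition Psi_defined :: "real \<Rightarrow> complex \<Rightarrow> (complex \<Rightarrow> complex) \<Rightarrow> bool" where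
  "Psi_defined a k f \<longleftrightarrow> imag_line_integrable (\<lambda>x. f x * delta a k x)"

definition Psi :: "real \<Rightarrow> complex \<Rightarrow> (complex \<Rightarrow> complex) \<Rightarrow> complex" where
  "Psi a k f = 1 / (\<i> * g_norm a k) * imag_line_integral (\<lambda>x. f x * delta a k x)"

text \<open>
  The zeros of the denominator lie on the imaginary line at the points where \<open>qpow a (2 * x) = 1\<close>;
  the value \<open>0\<close> given there by division by zero affects the integrals below only on a null set.
\<close>

definition shift_op :: "real \<Rightarrow> (complex \<Rightarrow> complex) \<Rightarrow> complex \<Rightarrow> complex" where
  "shift_op a f x = (f (x - 1/2) - f (x + 1/2)) / (qpow a x - qpow a (- x))"

text \<open>
  The integral of the twice shifted function involves \<open>f\<close> on the lines with real part
  \<open>-1\<close>, \<open>0\<close> and \<open>1\<close>, and is understood as an integral in which the contour may be moved across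
  the strip between them. Convergence on the imaginary line alone does not allow this (a function
  analytic in the strip may be small on the three lines and large in between), so the horizontal
  segments crossing the strip have to become negligible. Only arbitrarily high and
  arbitrarily low segments are needed, not all of them; uniform decay of \<open>f\<close>
  in the strip, or absolute integrability of \<open>f\<close> over the strip, implies this.
\<close>

definition contour_shift_admissible :: "(complex \<Rightarrow> complex) \<Rightarrow> bool" where
  "contour_shift_admissible f \<longleftrightarrow>
     (\<forall>\<epsilon>>0. (\<exists>\<^sub>F y in at_top. integral {-1..1} (\<lambda>s. norm (f (Complex s y))) < \<epsilon>) \<and>
            (\<exists>\<^sub>F y in at_bot. integral {-1..1} (\<lambda>s. norm (f (Complex s y))) < \<epsilon>))"

end

theory Submission
  imports Defs
begin

text \<open>
  On the imaginary line the integrand of the twice shifted function is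
  \<open>K (x - 1) (f (x - 1) - f x) + K (- x - 1) (f (x + 1) - f x)\<close> for a kernel \<open>K\<close> that is holomorphic on
  the strip \<open>-1 \<le> Re x \<le> 0\<close>: the zeros of the two denominators of the squared shift operator are zeros of
  the weight. As a continuous function of \<open>q\<close> to the power \<open>2 x\<close> on a compact annulus, \<open>K\<close> is bounded on the strip,
  so Cauchy's theorem moves the two shifted terms to \<open>K x f x\<close> and \<open>K (- x) f x\<close>, with an error bounded by
  the integrals of \<open>|f|\<close> over the horizontal segments. The resulting coefficient
  \<open>K x + K (- x) - K (x - 1) - K (- x - 1)\<close> of \<open>f x\<close> is a linear combination of the weights
  with parameters \<open>k\<close> and \<open>k + 1\<close>, which is a polynomial identity after the common infinite products
  have been cancelled.
\<close>

section \<open>The infinite q-Pochhammer symbol (z;q)_infinity\<close>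

definition qpoch :: "complex \<Rightarrow> complex \<Rightarrow> complex" where
  "qpoch q z = (\<Prod>j. 1 - z * q ^ j)"

lemma convergent_qpoch:
  fixes q z :: complex
  assumes "norm q < 1"
  shows "convergent_prod (\<lambda>j. 1 - z * q ^ j)"
proof (rule abs_convergent_prod_imp_convergent_prod, rule summable_imp_abs_convergent_prod)
  have "summable (\<lambda>j. norm z * norm q ^ j)"
    using assms by (intro summable_mult summable_geometric) simp
  thus "summable (\<lambda>j. norm (1 - z * q ^ j - 1))"
    by (simp add: norm_mult norm_power)
qed

lemma qpoch_LIMSEQ:
  assumes "norm q < 1"
  shows "(\<lambda>n. \<Prod>j<n. 1 - z * q ^ j) \<longlonglongrightarrow> qpoch q z"
  using convergent_prod_LIMSEQ[OF convergent_qpoch[OF assms, of z]]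
  by (simp add: qpoch_def LIMSEQ_lessThan_iff_atMost)

text \<open>The factor with index 0 is split off each partial product and the limit is taken. This
  functional equation is what relates the infinite products for different parameters.\<close>

lemma qpoch_rec:
  assumes "norm q < 1"
  shows "qpoch q z = (1 - z) * qpoch q (q * z)"
proof (rule LIMSEQ_unique)
  show "(\<lambda>n. \<Prod>j<Suc n. 1 - z * q ^ j) \<longlonglongrightarrow> qpoch q z"
    using qpoch_LIMSEQ[OF assms] by (rule LIMSEQ_Suc)
  have "(\<Prod>j<Suc n. 1 - z * q ^ j) = (1 - z) * (\<Prod>j<n. 1 - q * z * q ^ j)" for n
    by (subst prod.lessThan_Suc_shift) (simp add: mult_ac)
  thus "(\<lambda>n. \<Prod>j<Suc n. 1 - z * q ^ j) \<longlonglongrightarrow> (1 - z) * qpoch q (q * z)"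
    using tendsto_mult[OF tendsto_const qpoch_LIMSEQ[OF assms, of "q * z"], of "1 - z"] by presburger
qed

lemma qpoch_nonzero:
  assumes "norm q < 1" "norm z < 1"
  shows "qpoch q z \<noteq> 0"
  unfolding qpoch_def
proof (rule prodinf_nonzero[OF convergent_qpoch[OF assms(1)]])
  fix j
  have "norm (z * q ^ j) \<le> norm z * 1"
    unfolding norm_mult norm_power using assms by (intro mult_left_mono power_le_one) auto
  thus "1 - z * q ^ j \<noteq> 0" using assms by auto
qed

text \<open>The partial products are polynomials in z. On every closed disc of radius 1 the
  geometric majorant \<open>R * norm q ^ n\<close> makes them converge uniformly, so the limit is
  entire.\<close>

lemma holomorphic_qpoch:
  assumes "norm q < 1"
  shows "qpoch q holomorphic_on A"
proof -
  have "qpoch q holomorphic_on UNIV"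
  proof (rule holomorphic_uniform_sequence)
    show "open (UNIV :: complex set)" by simp
    show "(\<lambda>z. \<Prod>j<n. 1 - z * q ^ j) holomorphic_on UNIV" for n
      by (intro holomorphic_intros)
    show "\<exists>d>0. cball z d \<subseteq> UNIV \<and>
            uniform_limit (cball z d) (\<lambda>n z. \<Prod>j<n. 1 - z * q ^ j) (qpoch q) sequentially" for z
    proof (intro exI[of _ 1] conjI)
      define K where "K = cball z (1::real)"
      have "bounded K" by (simp add: K_def)
      then obtain R where R: "\<And>w. w \<in> K \<Longrightarrow> norm w \<le> R"
        by (auto simp: bounded_iff)
      have "uniformly_convergent_on K (\<lambda>N w. \<Sum>n<N. norm (1 - w * q ^ n - 1))"
      proof (rule Weierstrass_m_test'_ev[where M = "\<lambda>n. R * norm q ^ n"])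
        show "summable (\<lambda>n. R * norm q ^ n)"
          using assms by (intro summable_mult summable_geometric) simp
        show "\<forall>\<^sub>F n in sequentially. \<forall>x\<in>K. norm (norm (1 - x * q ^ n - 1)) \<le> R * norm q ^ n"
          using R by (intro always_eventually) (auto simp: norm_mult norm_power intro!: mult_right_mono)
      qed
      hence "uniformly_convergent_on K (\<lambda>N w. \<Prod>n<N. 1 - w * q ^ n)"
        by (intro uniformly_convergent_on_prod') (auto simp: K_def intro!: continuous_intros)
      then obtain l where l: "uniform_limit K (\<lambda>N w. \<Prod>n<N. 1 - w * q ^ n) l sequentially"
        by (auto simp: uniformly_convergent_on_def)
      \<comment> \<open>The uniform limit is so far only some function; pointwise uniqueness of
        limits identifies it.\<close>
      have "l w = qpoch q w" if "w \<in> K" for w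
        using tendsto_uniform_limitI[OF l that] qpoch_LIMSEQ[OF assms] by (rule LIMSEQ_unique)
      with l show "uniform_limit (cball z 1) (\<lambda>n z. \<Prod>j<n. 1 - z * q ^ j) (qpoch q) sequentially"
        unfolding K_def by (subst (asm) uniform_limit_cong') auto
    qed auto
  qed
  thus ?thesis by (rule holomorphic_on_subset) auto
qed

section \<open>Powers of q; normalisation and weight as quotients of q-Pochhammer symbols\<close>

lemma qpow_add: "qpow a (x + y) = qpow a x * qpow a y"
  by (simp add: qpow_def diff_divide_distrib flip: exp_add)

lemma qpow_minus: "qpow a (- x) = inverse (qpow a x)"
  by (simp add: qpow_def exp_minus)

lemma qpow_nonzero [simp]: "qpow a x \<noteq> 0"
  by (simp add: qpow_def)

lemma qpow_of_nat_mult: "qpow a (of_nat n * x) = qpow a x ^ n"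
  by (simp add: qpow_def flip: exp_of_nat_mult)

lemma norm_qpow: "norm (qpow a x) = exp (- Re x / a)"
  by (simp add: qpow_def)

lemma norm_qpow_less_1_iff: "a > 0 \<Longrightarrow> norm (qpow a x) < 1 \<longleftrightarrow> Re x > 0"
  by (simp add: norm_qpow zero_less_divide_iff)

lemma g_norm_qpoch:
  assumes "a > 0"
  shows "g_norm a k = qpoch (qpow a 1) (qpow a k) / qpoch (qpow a 1) (qpow a k ^ 2)"
proof -
  have q: "norm (qpow a 1) < 1" using assms by (simp add: norm_qpow)
  have "qpow a (2 * k) = qpow a k ^ 2" using qpow_of_nat_mult[of a 2 k] by simp
  moreover have "qpow a (of_nat j) = qpow a 1 ^ j" for j using qpow_of_nat_mult[of a j 1] by simp
  ultimately show ?thesis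
    unfolding g_norm_def qpoch_def using convergent_qpoch[OF q] 
    by (simp add: prodinf_divide qpow_add)
qed

text \<open>Quotients of convergent products are taken factor by factor. Where a factor of the
  denominator vanishes, both sides are 0 by the convention for division by zero.\<close>

lemma delta_qpoch:
  fixes k x :: complex
  assumes "a > 0"
  defines "q \<equiv> qpow a 1" and "w \<equiv> qpow a (2 * x)" and "t \<equiv> qpow a k"
  shows "delta a k x = qpoch q w * qpoch q (1 / w) / (qpoch q (t * w) * qpoch q (t / w))"
proof -
  have q: "norm q < 1" using assms by (simp add: norm_qpow)
  have nat: "qpow a (of_nat j) = q ^ j" for j using qpow_of_nat_mult[of a j 1] by (simp add: q_def)
  have minus: "qpow a (- 2 * x) = 1 / w" using qpow_minus[of a "2*x"] by (simp add: w_def field_simps)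
  have cp: "convergent_prod (\<lambda>j. (1 - y * q ^ j) * (1 - z * q ^ j))" for y z
    using convergent_qpoch[OF q] by (intro convergent_prod_mult)
  have "delta a k x = (\<Prod>j. ((1 - w * q ^ j) * (1 - 1 / w * q ^ j)) /
                            ((1 - t * w * q ^ j) * (1 - t / w * q ^ j)))"
    unfolding delta_def qpow_add nat minus w_def[symmetric] t_def[symmetric]
    by (intro prodinf_cong) (simp add: mult_ac)
  also have "\<dots> = (\<Prod>j. (1 - w * q ^ j) * (1 - 1 / w * q ^ j)) / (\<Prod>j. (1 - t * w * q ^ j) * (1 - t / w * q ^ j))"
    by (rule prodinf_divide[OF cp cp, symmetric])
  also have "\<dots> = qpoch q w * qpoch q (1 / w) / (qpoch q (t * w) * qpoch q (t / w))"
    unfolding qpoch_def by (simp only: prodinf_mult[OF convergent_qpoch[OF q] convergent_qpoch[OF q]])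
  finally show ?thesis .
qed

section \<open>The kernel: holomorphy and boundedness on the strip\<close>

text \<open>
  With \<open>w\<close> for \<open>q\<close> to the power \<open>2 x\<close> and \<open>t\<close> for \<open>q\<close> to the power \<open>k\<close>, this is, up to a constant,
  the coefficient of \<open>f (x - 1)\<close> in the twice shifted integrand, translated by \<open>1\<close> and with the common
  zeros of numerator and denominator cancelled.
\<close>

definition annulus_kernel :: "complex \<Rightarrow> complex \<Rightarrow> complex \<Rightarrow> complex" where
  "annulus_kernel q t w =
     qpoch q (q ^ 2 * w) * qpoch q (1 / w) / (w * qpoch q (t * q ^ 4 * w) * qpoch q (t / w))"

text \<open>The constant is normalised so that the value at \<open>x - 1\<close> is exactly the
  coefficient of \<open>f (x - 1)\<close> in the twice shifted integrand with the weight of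
  parameter \<open>k + 2\<close>.\<close>

definition shift_kernel :: "real \<Rightarrow> complex \<Rightarrow> complex \<Rightarrow> complex" where
  "shift_kernel a k x = annulus_kernel (qpow a 1) (qpow a k) (qpow a (2 * x)) / qpow a (3/2)"

text \<open>On this annulus the arguments \<open>t * q ^ 4 * w\<close> and \<open>t / w\<close> have
  norm at most \<open>norm t\<close>, hence less than 1, and there \<open>qpoch\<close> has no
  zeros. So the denominator does not vanish, even on the boundary circles.\<close>

lemma holomorphic_annulus_kernel:
  assumes "norm q < 1" "norm t < 1"
  shows "annulus_kernel q t holomorphic_on {w. 1 \<le> norm w \<and> norm (q ^ 2 * w) \<le> 1}"
proof -
  have *: "(\<lambda>w. qpoch q (h w)) holomorphic_on A" if "h holomorphic_on A" for h A
    using holomorphic_on_compose[OF that holomorphic_qpoch[OF assms(1)]] by (simp add: o_def)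
  have "norm (t * q ^ 4 * w) < 1" "norm (t / w) < 1" 
    if w: "1 \<le> norm w" "norm (q ^ 2 * w) \<le> 1" for w
  proof -
    have "norm (t * q ^ 4 * w) = norm t * norm q ^ 2 * norm (q ^ 2 * w)"
      by (simp add: norm_mult norm_power power2_eq_square eval_nat_numeral)
    also have "\<dots> \<le> norm t * 1 * 1"
      using assms w by (intro mult_mono power_le_one) auto
    finally show "norm (t * q ^ 4 * w) < 1" using assms by simp
    have "norm t < norm w" using assms w by linarith
    thus "norm (t / w) < 1" using w by (simp add: norm_divide divide_less_eq)
  qed
  thus ?thesis unfolding annulus_kernel_def
    using assms by (intro holomorphic_intros *) (auto simp: qpoch_nonzero)
qed

lemma qpow_strip_annulus:
  assumes "a > 0" "Re x \<in> {-1..0}"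
  shows "1 \<le> norm (qpow a (2 * x)) \<and> norm (qpow a 1 ^ 2 * qpow a (2 * x)) \<le> 1"
proof -
  have "qpow a 1 ^ 2 * qpow a (2 * x) = qpow a (2 + 2 * x)"
    using qpow_of_nat_mult[of a 2 1] by (simp add: qpow_add)
  thus ?thesis using assms by (auto simp: norm_qpow divide_nonpos_pos)
qed

lemma holomorphic_shift_kernel:
  assumes "a > 0" "Re k > 0"
  shows "shift_kernel a k holomorphic_on {x. Re x \<in> {-1..0}}"
proof -
  have "(\<lambda>x. qpow a (2 * x)) holomorphic_on A" for A
    unfolding qpow_def using assms by (intro holomorphic_intros) auto
  hence "(annulus_kernel (qpow a 1) (qpow a k) \<circ> (\<lambda>x. qpow a (2 * x))) holomorphic_on {x. Re x \<in> {-1..0}}"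
    by (rule holomorphic_on_compose_gen[OF _ holomorphic_annulus_kernel])
       (use assms qpow_strip_annulus in \<open>auto simp: norm_qpow_less_1_iff\<close>)
  thus ?thesis unfolding shift_kernel_def
    by (intro holomorphic_intros) (auto simp: o_def)
qed

lemma bounded_shift_kernel:
  assumes "a > 0" "Re k > 0"
  obtains M where "M > 0" "\<And>x. Re x \<in> {-1..0} \<Longrightarrow> norm (shift_kernel a k x) \<le> M"
proof -
  define q where "q = qpow a 1"
  define T where "T = {w. 1 \<le> norm w \<and> norm (q ^ 2 * w) \<le> 1}"
  have q: "norm q < 1" "q \<noteq> 0" using assms by (simp_all add: q_def norm_qpow)
  have "compact T"
  proof (rule compact_Int_closed[of "cball 0 (1 / norm q ^ 2)" "{w. 1 \<le> norm w}", THEN back_subst[of compact]])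
    show "closed {w :: complex. 1 \<le> norm w}" by (intro closed_Collect_le continuous_intros)
  \<comment> \<open>Boundedness of the annulus uses that q is nonzero: its outer radius is
    \<open>1 / norm q ^ 2\<close>.\<close>
  qed (use q in \<open>auto simp: T_def norm_mult norm_power field_simps\<close>)
  moreover have "continuous_on T (annulus_kernel q (qpow a k))"
    unfolding T_def using assms q
    by (intro holomorphic_on_imp_continuous_on holomorphic_annulus_kernel) (auto simp: norm_qpow_less_1_iff)
  ultimately have "bounded (annulus_kernel q (qpow a k) ` T)"
    by (intro compact_imp_bounded compact_continuous_image)
  then obtain M where M: "M > 0" "\<And>w. w \<in> T \<Longrightarrow> norm (annulus_kernel q (qpow a k) w) \<le> M"
    unfolding bounded_pos by auto
  show thesis
  proof (rule that[of "M / norm (qpow a (3/2))"])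
    fix x assume "Re x \<in> {-1..0}"
    with qpow_strip_annulus[OF assms(1)] M(2)[of "qpow a (2 * x)"]
    show "norm (shift_kernel a k x) \<le> M / norm (qpow a (3/2))"
      by (auto simp: shift_kernel_def T_def q_def norm_divide intro!: divide_right_mono)
  qed (use M in auto)
qed

section \<open>The squared shift operator expressed through the kernel\<close>

lemma qpoch_rec2:
  assumes "norm q < 1"
  shows "qpoch q z = (1 - z) * (1 - q * z) * qpoch q (q ^ 2 * z)"
  using qpoch_rec[OF assms, of z] qpoch_rec[OF assms, of "q * z"] by (simp add: power2_eq_square mult_ac)

lemma qpoch_1: "norm q < 1 \<Longrightarrow> qpoch q 1 = 0"
  using qpoch_rec[of q 1] by simp

lemma qpow_2_mult: "qpow a (2 * x) = qpow a x ^ 2"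
  using qpow_of_nat_mult[of a 2 x] by simp

text \<open>Translating x by -1 divides w by \<open>q ^ 2\<close>. The two products in the
  denominator then become those of the weight with parameter \<open>k + 2\<close>, and the powers
  \<open>q ^ 2\<close> and q^(-3/2) combine to q^(1/2).\<close>

lemma shift_kernel_minus_1:
  fixes a :: real and k x :: complex
  defines "q \<equiv> qpow a 1" and "t \<equiv> qpow a k" and "w \<equiv> qpow a (2 * x)"
  shows "shift_kernel a k (x - 1) = qpow a (1/2) * qpoch q w * qpoch q (q ^ 2 / w) /
           (w * (qpoch q (t * q ^ 2 * w) * qpoch q (t * q ^ 2 / w)))"
proof -
  define s where "s = qpow a (1/2)"
  have nz: "s \<noteq> 0" "q \<noteq> 0" "w \<noteq> 0" by (simp_all add: s_def q_def w_def)
  have q: "q = s ^ 2" using qpow_2_mult[of a "1/2"] by (simp add: s_def q_def)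
  have s3: "qpow a (3/2) = s ^ 3" using qpow_of_nat_mult[of a 3 "1/2"] by (simp add: s_def)
  have "2 * (x - 1) = 2 * x + - (2 * 1)" by simp
  hence w1: "qpow a (2 * (x - 1)) = w / q ^ 2"
    by (simp only: qpow_add qpow_minus q_def w_def divide_inverse qpow_2_mult[of a 1])
  have "shift_kernel a k (x - 1) =
      qpoch q w * qpoch q (q ^ 2 / w) / (w / q ^ 2 * (qpoch q (t * q ^ 2 * w) * qpoch q (t * q ^ 2 / w))) / s ^ 3"
    unfolding shift_kernel_def annulus_kernel_def w1 s3 q_def[symmetric] t_def[symmetric] using nz
    by (simp add: power2_eq_square eval_nat_numeral mult_ac)
  also have "\<dots> = s * qpoch q w * qpoch q (q ^ 2 / w) /
           (w * (qpoch q (t * q ^ 2 * w) * qpoch q (t * q ^ 2 / w)))"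
  proof -
    have "q ^ 2 = s * s ^ 3" by (simp add: q eval_nat_numeral)
    thus ?thesis using nz by simp
  qed
  finally show ?thesis by (simp add: s_def)
qed

text \<open>Up to monomials, the denominators of the squared shift operator are the first two
  factors of \<open>qpoch q (1 / w)\<close> for the term with \<open>f (x - 1)\<close>, and of
  \<open>qpoch q w\<close> for the term with \<open>f (x + 1)\<close>. Cancelling them against the
  weight leaves the kernel; the two terms are exchanged by the reflection of x to -x.\<close>

lemma shift_op_delta:
  assumes a: "a > 0" and k: "Re k > 0" and x: "Re x = 0"
  shows "shift_op a (shift_op a f) x * delta a (k + 2) x =
           shift_kernel a k (x - 1) * (f (x - 1) - f x) + shift_kernel a k (- x - 1) * (f (x + 1) - f x)"
proof -
  define s y t where "s = qpow a (1/2)" and "y = qpow a x" and "t = qpow a k"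
  define q w where "q = s ^ 2" and "w = y ^ 2"
  have nz: "s \<noteq> 0" "y \<noteq> 0" "t \<noteq> 0" "q \<noteq> 0" "w \<noteq> 0" by (simp_all add: s_def y_def t_def q_def w_def)
  have q: "qpow a 1 = q" using qpow_of_nat_mult[of a 2 "1/2"] by (simp add: s_def q_def)
  have w: "qpow a (2 * x) = w" using qpow_of_nat_mult[of a 2 x] by (simp add: y_def w_def)
  have q2: "qpow a 2 = q ^ 2" using qpow_2_mult[of a 1] by (simp add: q)
  have norm_q: "norm q < 1" using a by (simp add: norm_qpow flip: q)
  have norm_w: "norm w = 1" using x by (simp add: norm_qpow flip: w)
  have t2: "qpow a (k + 2) = t * q ^ 2" by (simp add: qpow_add t_def q2)
  define Z where "Z = qpoch q (t * q ^ 2 * w) * qpoch q (t * q ^ 2 / w)"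
  have D: "delta a (k + 2) x = qpoch q w * qpoch q (1 / w) / Z"
    by (simp add: delta_qpoch[OF a] q w t2 Z_def)
  have K1: "shift_kernel a k (x - 1) = s * qpoch q w * qpoch q (q ^ 2 / w) / (w * Z)"
    by (simp add: shift_kernel_minus_1 q w t_def Z_def flip: s_def)
  have mw: "qpow a (2 * - x) = 1 / w" 
    using qpow_minus[of a "2 * x"] by (simp add: w inverse_eq_divide)
  have K2: "shift_kernel a k (- x - 1) = s * w * qpoch q (1 / w) * qpoch q (q ^ 2 * w) / Z"
    unfolding shift_kernel_minus_1[of a k "- x", unfolded mw q, folded s_def t_def] Z_def
    using nz by (simp add: mult_ac)
  show ?thesis
  proof (cases "w = 1")
    \<comment> \<open>Here the outer denominator of the shift vanishes, but the weight and both
      kernel values contain the factor \<open>qpoch q 1 = 0\<close>, so both sides are 0.\<close>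
    case True
    thus ?thesis unfolding D K1 K2 by (simp add: qpoch_1 norm_q)
  next
    case False
    \<comment> \<open>Since x is imaginary, w lies on the unit circle, so the inner denominators
      have no zeros there.\<close>
    have "norm (q * w) < 1" "norm (q / w) < 1" 
      using norm_q norm_w by (simp_all add: norm_mult norm_divide)
    hence ne: "1 - q * w \<noteq> 0" "1 - q / w \<noteq> 0" "1 - w \<noteq> 0" "1 - 1 / w \<noteq> 0" using False by auto
    have sh: "qpow a (x - 1/2) = y / s" "qpow a (- (x - 1/2)) = s / y"
      "qpow a (x + 1/2) = y * s" "qpow a (- (x + 1/2)) = 1 / (y * s)" "qpow a (- x) = 1 / y"
    proof -
      have "qpow a (x + - (1/2)) = y / s"
        by (simp only: qpow_add qpow_minus y_def s_def divide_inverse)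
      thus m: "qpow a (x - 1/2) = y / s" by simp
      show p: "qpow a (x + 1/2) = y * s" by (simp only: qpow_add y_def s_def)
      show "qpow a (- (x - 1/2)) = s / y" "qpow a (- (x + 1/2)) = 1 / (y * s)" "qpow a (- x) = 1 / y"
        unfolding qpow_minus m p by (simp_all add: y_def divide_inverse)
    qed
    \<comment> \<open>The outer denominator is factored in two ways, so that it can cancel against
      either of the products in w and in 1/w.\<close>
    have e: "y - 1 / y = - (1 - w) / y" "y - 1 / y = y * (1 - 1 / w)"
      "y / s - s / y = y / s * (1 - q / w)" "y * s - 1 / (y * s) = - (1 - q * w) / (y * s)"
      using nz by (simp_all add: q_def w_def field_simps power2_eq_square)
    have R1: "qpoch q (q ^ 2 / w) = qpoch q (1 / w) / ((1 - 1 / w) * (1 - q / w))"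
      using qpoch_rec2[OF norm_q, of "1 / w"] ne by simp
    have R2: "qpoch q (q ^ 2 * w) = qpoch q w / ((1 - w) * (1 - q * w))"
      using qpoch_rec2[OF norm_q, of w] ne by simp
    have S1: "shift_kernel a k (x - 1) = delta a (k + 2) x / ((y - 1 / y) * (y / s - s / y))"
      unfolding K1 D R1 e(2,3) using nz ne by (simp add: q_def w_def power2_eq_square mult_ac)
    have S2: "shift_kernel a k (- x - 1) = delta a (k + 2) x / ((y - 1 / y) * (y * s - 1 / (y * s)))"
      unfolding K2 D R2 e(1,4) using nz ne
      by (simp add: q_def w_def power2_eq_square mult_ac) (simp add: algebra_simps)
    have so: "shift_op a (shift_op a f) x =
        ((f (x - 1) - f x) / (y / s - s / y) - (f x - f (x + 1)) / (y * s - 1 / (y * s))) / (y - 1 / y)"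
    proof -
      have "x - 1/2 - 1/2 = x - 1" "x - 1/2 + 1/2 = x" "x + 1/2 - 1/2 = x" "x + 1/2 + 1/2 = x + 1"
        by simp_all
      thus ?thesis unfolding shift_op_def sh by (simp only: y_def)
    qed
    have "((A - B) / u - (B - C) / v) / r * D = D / (r * u) * (A - B) + D / (r * v) * (C - B)" for A B C u v r D :: complex
      by (simp add: add_divide_distrib diff_divide_distrib algebra_simps)
    thus ?thesis unfolding S1 S2 so .
  qed
qed

section \<open>The coefficient of \<open>f x\<close> as a combination of two weights\<close>

text \<open>This is the coefficient identity with all denominators cleared. In the last bracket,
  \<open>(1 + t) * (1 - t ^ 2 * q)\<close> comes from the ratio of the normalisations for
  \<open>k + 1\<close> and \<open>k\<close>, and \<open>(1 - t * w) * (w - t)\<close> is w times the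
  ratio of the corresponding weights.\<close>

lemma kernel_polynomial_identity:
  fixes q t w :: complex
  shows "t * ((w - 1) * (w - q) * ((1 - t * w) * (1 - t * q * w) * (1 - t * q ^ 2 * w) * (1 - t * q ^ 3 * w))
       + (1 - w) * (1 - q * w) * ((w - t) * (w - t * q) * (w - t * q ^ 2) * (w - t * q ^ 3))
       - q ^ 2 * ((1 - w) * (1 - q * w) + (w - 1) * (w - q)) * ((1 - t * w) * (1 - t * q * w) * (w - t) * (w - t * q)))
     = (1 - w) * (1 - q * w) * (w - 1) * (w - q) * (1 + t * q) * (1 - t ^ 2 * q ^ 3)
       * ((1 + t) * (1 - t ^ 2 * q) * w - (1 - t * q) * (1 - t * w) * (w - t))"
  by algebra

text \<open>The first two summands on the left stand for the kernel at x and -x, the third for its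
  values at \<open>x - 1\<close> and \<open>- x - 1\<close>, all without their common infinite
  products. Over the common denominator the numerators agree by the polynomial identity.\<close>

lemma kernel_rational_identity:
  fixes q t w :: complex
  assumes w: "w \<noteq> 0" and t: "t \<noteq> 0"
    and d: "1 - t * w \<noteq> 0" "1 - t * q * w \<noteq> 0" "1 - t * q ^ 2 * w \<noteq> 0" "1 - t * q ^ 3 * w \<noteq> 0"
    and e: "1 - t / w \<noteq> 0" "1 - t * q / w \<noteq> 0" "1 - t * q ^ 2 / w \<noteq> 0" "1 - t * q ^ 3 / w \<noteq> 0"
  shows "(1 - 1 / w) * (1 - q / w) / (w * ((1 - t / w) * (1 - t * q / w) * (1 - t * q ^ 2 / w) * (1 - t * q ^ 3 / w)))
       + w * (1 - w) * (1 - q * w) / ((1 - t * w) * (1 - t * q * w) * (1 - t * q ^ 2 * w) * (1 - t * q ^ 3 * w))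
       - q ^ 2 * ((1 - w) * (1 - q * w) / w + w * (1 - 1 / w) * (1 - q / w))
         / ((1 - t * q ^ 2 * w) * (1 - t * q ^ 3 * w) * (1 - t * q ^ 2 / w) * (1 - t * q ^ 3 / w))
     = (1 - w) * (1 - q * w) * (1 - 1 / w) * (1 - q / w) * (1 + t * q) * (1 - t ^ 2 * q ^ 3)
       * ((1 + t) * (1 - t ^ 2 * q) - (1 - t * q) * (1 - t * w) * (1 - t / w))
       / (t * ((1 - t * w) * (1 - t * q * w) * (1 - t * q ^ 2 * w) * (1 - t * q ^ 3 * w)
         * ((1 - t / w) * (1 - t * q / w) * (1 - t * q ^ 2 / w) * (1 - t * q ^ 3 / w))))"
proof -
  define d0 d1 d2 d3 where "d0 = 1 - t * w" and "d1 = 1 - t * q * w" and "d2 = 1 - t * q ^ 2 * w" and "d3 = 1 - t * q ^ 3 * w"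
  define e0 e1 e2 e3 where "e0 = w - t" and "e1 = w - t * q" and "e2 = w - t * q ^ 2" and "e3 = w - t * q ^ 3"
  have div: "1 - 1 / w = (w - 1) / w" "1 - q / w = (w - q) / w" "1 - t / w = e0 / w" "1 - t * q / w = e1 / w"
    "1 - t * q ^ 2 / w = e2 / w" "1 - t * q ^ 3 / w = e3 / w"
    using w by (simp_all add: e0_def e1_def e2_def e3_def diff_divide_distrib)
  have dn: "d0 \<noteq> 0" "d1 \<noteq> 0" "d2 \<noteq> 0" "d3 \<noteq> 0" using d by (simp_all add: d0_def d1_def d2_def d3_def)
  have en: "e0 \<noteq> 0" "e1 \<noteq> 0" "e2 \<noteq> 0" "e3 \<noteq> 0" using e unfolding div by auto
  have *: "t * ((w - 1) * (w - q) * (d0 * d1 * d2 * d3) + (1 - w) * (1 - q * w) * (e0 * e1 * e2 * e3)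
       - q ^ 2 * ((1 - w) * (1 - q * w) + (w - 1) * (w - q)) * (d0 * d1 * e0 * e1))
     = (1 - w) * (1 - q * w) * (w - 1) * (w - q) * (1 + t * q) * (1 - t ^ 2 * q ^ 3)
       * ((1 + t) * (1 - t ^ 2 * q) * w - (1 - t * q) * d0 * e0)"
    unfolding d0_def d1_def d2_def d3_def e0_def e1_def e2_def e3_def by (rule kernel_polynomial_identity)
  have "(w - 1) / w * ((w - q) / w) / (w * (e0 / w * (e1 / w) * (e2 / w) * (e3 / w)))
       + w * (1 - w) * (1 - q * w) / (d0 * d1 * d2 * d3)
       - q ^ 2 * ((1 - w) * (1 - q * w) / w + w * ((w - 1) / w) * ((w - q) / w)) / (d2 * d3 * (e2 / w) * (e3 / w))
      = w * ((w - 1) * (w - q) * (d0 * d1 * d2 * d3) + (1 - w) * (1 - q * w) * (e0 * e1 * e2 * e3)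
       - q ^ 2 * ((1 - w) * (1 - q * w) + (w - 1) * (w - q)) * (d0 * d1 * e0 * e1)) / (d0 * d1 * d2 * d3 * (e0 * e1 * e2 * e3))"
    (is "?L = w * ?N / ?D")
  proof -
    have "(w - 1) / w * ((w - q) / w) / (w * (e0 / w * (e1 / w) * (e2 / w) * (e3 / w))) = w * ((w - 1) * (w - q) * (d0 * d1 * d2 * d3)) / ?D"
      using w dn en by (simp add: divide_simps)
    moreover have "w * (1 - w) * (1 - q * w) / (d0 * d1 * d2 * d3) = w * ((1 - w) * (1 - q * w) * (e0 * e1 * e2 * e3)) / ?D"
      using w dn en by (simp add: divide_simps)
    moreover have "(1 - w) * (1 - q * w) / w + w * ((w - 1) / w) * ((w - q) / w) = ((1 - w) * (1 - q * w) + (w - 1) * (w - q)) / w"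
      using w by (simp add: add_divide_distrib)
    moreover have "q ^ 2 * (y / w) / (d2 * d3 * (e2 / w) * (e3 / w)) = w * (q ^ 2 * y * (d0 * d1 * e0 * e1)) / ?D" for y
      using w dn en by (simp add: divide_simps)
    ultimately show ?thesis
      by (simp only: add_divide_distrib diff_divide_distrib ring_distribs)
  qed
  \<comment> \<open>The polynomial identity evaluates t times the numerator, hence the expansion by
    t.\<close>
  also have "\<dots> = w * (t * ?N) / (t * ?D)" using t by simp
  also have "\<dots> = (1 - w) * (1 - q * w) * ((w - 1) / w) * ((w - q) / w) * (1 + t * q) * (1 - t ^ 2 * q ^ 3)
       * ((1 + t) * (1 - t ^ 2 * q) - (1 - t * q) * d0 * (e0 / w))
       / (t * (d0 * d1 * d2 * d3 * (e0 / w * (e1 / w) * (e2 / w) * (e3 / w))))"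
  proof -
    have "(1 + t) * (1 - t ^ 2 * q) - (1 - t * q) * d0 * (e0 / w) = ((1 + t) * (1 - t ^ 2 * q) * w - (1 - t * q) * d0 * e0) / w"
      using w by (simp add: diff_divide_distrib)
    moreover have "w * ((1 - w) * (1 - q * w) * (w - 1) * (w - q) * (1 + t * q) * (1 - t ^ 2 * q ^ 3) * y) / (t * ?D)
        = (1 - w) * (1 - q * w) * ((w - 1) / w) * ((w - q) / w) * (1 + t * q) * (1 - t ^ 2 * q ^ 3) * (y / w)
       / (t * (d0 * d1 * d2 * d3 * (e0 / w * (e1 / w) * (e2 / w) * (e3 / w))))" for y
      using w t dn en by (simp add: divide_simps)
    ultimately show ?thesis unfolding * by simp
  qed
  finally show ?thesis
    unfolding div d0_def[symmetric] d1_def[symmetric] d2_def[symmetric] d3_def[symmetric] .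
qed

lemma g_norm_nonzero:
  assumes "a > 0" "Re k > 0"
  shows "g_norm a k \<noteq> 0"
  using assms by (simp add: g_norm_qpoch qpoch_nonzero norm_qpow_less_1_iff norm_power power_less_one_iff)

text \<open>Raising k by 1 removes one factor from the product in t and two from the product in
  \<open>t ^ 2\<close>; then \<open>1 - t ^ 2\<close> over \<open>1 - t\<close> reduces to
  \<open>1 + t\<close>.\<close>

lemma g_norm_plus_1:
  assumes "a > 0" "Re k > 0"
  shows "g_norm a (k + 1) = g_norm a k * ((1 + qpow a k) * (1 - qpow a k ^ 2 * qpow a 1))"
proof -
  define q t where "q = qpow a 1" and "t = qpow a k"
  have q: "norm q < 1" and t: "norm t < 1" using assms by (simp_all add: q_def t_def norm_qpow_less_1_iff)
  have t2: "norm (t ^ 2) < 1" using t by (simp add: norm_power power_less_one_iff)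
  have "norm (t ^ 2 * q) < 1"
    using t2 q mult_left_mono[of "norm q" 1 "norm (t ^ 2)"] by (simp add: norm_mult)
  hence ne: "1 - t ^ 2 \<noteq> 0" "1 - t ^ 2 * q \<noteq> 0" "1 - t \<noteq> 0" using t t2 by auto
  have "qpow a (k + 1) = q * t" by (simp add: qpow_add q_def t_def)
  hence "g_norm a (k + 1) = qpoch q (q * t) / qpoch q (q ^ 2 * t ^ 2)"
    using assms by (simp add: g_norm_qpoch q_def power_mult_distrib)
  also have "qpoch q (q * t) = qpoch q t / (1 - t)"
    using qpoch_rec[OF q, of t] ne by simp
  also have "qpoch q (q ^ 2 * t ^ 2) = qpoch q (t ^ 2) / ((1 - t ^ 2) * (1 - t ^ 2 * q))"
    using qpoch_rec2[OF q, of "t ^ 2"] ne by (simp add: mult_ac)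
  also have "qpoch q t / (1 - t) / (qpoch q (t ^ 2) / ((1 - t ^ 2) * (1 - t ^ 2 * q)))
             = qpoch q t / qpoch q (t ^ 2) * ((1 - t ^ 2) / (1 - t) * (1 - t ^ 2 * q))"
    by simp
  also have "(1 - t ^ 2) / (1 - t) = 1 + t"
    using ne by (simp add: divide_simps) (simp add: algebra_simps power2_eq_square)
  finally show ?thesis using assms by (simp add: g_norm_qpoch q_def t_def)
qed

text \<open>Splitting off finitely many factors reduces the four kernel values and the two weights
  to the same infinite products, after which only the rational identity in q, t, w remains. On the
  imaginary line w has norm 1, so no factor split off a denominator is 0.\<close>

lemma shift_kernel_identity:
  assumes a: "a > 0" and k: "Re k > 0" and x: "Re x = 0"
  shows "shift_kernel a k x + shift_kernel a k (- x) - shift_kernel a k (x - 1) - shift_kernel a k (- x - 1) =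
           (g_norm a (k + 2) / g_norm a k * delta a k x
             - (1 - qpow a (k + 1)) * (g_norm a (k + 2) / g_norm a (k + 1)) * delta a (k + 1) x) / qpow a (k + 3/2)"
proof -
  define s q t w where "s = qpow a (1/2)" and "q = qpow a 1" and "t = qpow a k" and "w = qpow a (2 * x)"
  have nz: "s \<noteq> 0" "t \<noteq> 0" "q \<noteq> 0" "w \<noteq> 0" by (simp_all add: s_def t_def q_def w_def)
  \<comment> \<open>This gives the translated kernel values the same prefactor q^(-3/2) as the
    untranslated ones.\<close>
  have s: "s = q ^ 2 / s ^ 3" 
    using qpow_2_mult[of a "1/2"] nz by (simp add: s_def q_def divide_simps eval_nat_numeral)
  have s3: "qpow a (3/2) = s ^ 3" using qpow_of_nat_mult[of a 3 "1/2"] by (simp add: s_def)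
  have mw: "qpow a (2 * - x) = 1 / w" 
    using qpow_minus[of a "2 * x"] by (simp add: w_def inverse_eq_divide)
  have q: "norm q < 1" and t: "norm t < 1" using assms by (simp_all add: q_def t_def norm_qpow_less_1_iff)
  have norm_w: "norm w = 1" using x by (simp add: norm_qpow w_def)
  have "norm (t * q ^ j) < 1" for j
  proof -
    have "norm (t * q ^ j) \<le> norm t * 1"
      unfolding norm_mult norm_power using q by (intro mult_left_mono power_le_one) auto
    thus ?thesis using t by simp
  qed
  hence "norm (t * q ^ j * w) < 1" "norm (t * q ^ j / w) < 1" for j
    using norm_w by (simp_all add: norm_mult norm_divide)
  note less_1 = this
  have "1 - z \<noteq> 0" if "norm z < 1" for z :: complex using that by auto
  hence dn: "1 - t * q ^ j * w \<noteq> 0" and en: "1 - t * q ^ j / w \<noteq> 0" for j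
    using less_1 by blast+
  \<comment> \<open>These are the tails shared by all four kernel values and both weights.\<close>
  define P R U V where "P = qpoch q (q ^ 2 * w)" and "R = qpoch q (q ^ 2 / w)"
    and "U = qpoch q (t * q ^ 4 * w)" and "V = qpoch q (t * q ^ 4 / w)"
  define d0 d1 d2 d3 where "d0 = 1 - t * w" and "d1 = 1 - t * q * w" and "d2 = 1 - t * q ^ 2 * w" and "d3 = 1 - t * q ^ 3 * w"
  define e0 e1 e2 e3 where "e0 = 1 - t / w" and "e1 = 1 - t * q / w" and "e2 = 1 - t * q ^ 2 / w" and "e3 = 1 - t * q ^ 3 / w"
  have ne: "d0 \<noteq> 0" "d1 \<noteq> 0" "d2 \<noteq> 0" "d3 \<noteq> 0" "e0 \<noteq> 0" "e1 \<noteq> 0" "e2 \<noteq> 0" "e3 \<noteq> 0"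
    using dn[of 0] dn[of 1] dn[of 2] dn[of 3] en[of 0] en[of 1] en[of 2] en[of 3]
    by (simp_all add: d0_def d1_def d2_def d3_def e0_def e1_def e2_def e3_def)
  have pw: "qpoch q w = (1 - w) * (1 - q * w) * P" "qpoch q (1 / w) = (1 - 1 / w) * (1 - q / w) * R"
    using qpoch_rec2[OF q, of w] qpoch_rec2[OF q, of "1 / w"] by (simp_all add: P_def R_def)
  have p2: "qpoch q (t * q ^ 2 * w) = d2 * d3 * U" "qpoch q (t * q ^ 2 / w) = e2 * e3 * V"
    using qpoch_rec2[OF q, of "t * q ^ 2 * w"] qpoch_rec2[OF q, of "t * q ^ 2 / w"]
    by (simp_all add: d2_def d3_def e2_def e3_def U_def V_def mult_ac eval_nat_numeral)
  have p1: "qpoch q (t * q * w) = d1 * (d2 * d3 * U)" "qpoch q (t * q / w) = e1 * (e2 * e3 * V)"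
    using qpoch_rec[OF q, of "t * q * w"] qpoch_rec[OF q, of "t * q / w"] p2
    by (simp_all add: d1_def e1_def mult_ac eval_nat_numeral)
  have p0: "qpoch q (t * w) = d0 * (d1 * (d2 * d3 * U))" "qpoch q (t / w) = e0 * (e1 * (e2 * e3 * V))"
    using qpoch_rec[OF q, of "t * w"] qpoch_rec[OF q, of "t / w"] p1
    by (simp_all add: d0_def e0_def mult_ac)
  define C where "C = P * R / (U * V * s ^ 3)"
  have K0: "shift_kernel a k x = C * ((1 - 1 / w) * (1 - q / w) / (w * (e0 * e1 * e2 * e3)))"
    unfolding shift_kernel_def annulus_kernel_def s3 q_def[symmetric] t_def[symmetric] w_def[symmetric] p0 pw
      P_def[symmetric] U_def[symmetric] C_def by (simp add: mult_ac)
  have "shift_kernel a k (- x) = qpoch q (q ^ 2 / w) * qpoch q w / (1 / w * qpoch q (t * q ^ 4 / w) * qpoch q (t * w)) / s ^ 3"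
    unfolding shift_kernel_def annulus_kernel_def s3 q_def[symmetric] t_def[symmetric] mw by simp
  hence K0': "shift_kernel a k (- x) = C * (w * (1 - w) * (1 - q * w) / (d0 * d1 * d2 * d3))"
    unfolding p0 pw R_def[symmetric] V_def[symmetric] C_def by (simp add: mult_ac)
  have "shift_kernel a k (x - 1) = q ^ 2 / s ^ 3 * qpoch q w * R / (w * (d2 * d3 * U * (e2 * e3 * V)))"
    unfolding shift_kernel_minus_1 q_def[symmetric] t_def[symmetric] w_def[symmetric] s_def[symmetric]
      p2 R_def[symmetric] using s by simp
  hence K1: "shift_kernel a k (x - 1) = C * (q ^ 2 * ((1 - w) * (1 - q * w) / w) / (d2 * d3 * e2 * e3))"
    unfolding pw C_def by (simp add: mult_ac)
  have "shift_kernel a k (- x - 1) = s * qpoch q (1 / w) * P / (1 / w * (qpoch q (t * q ^ 2 / w) * qpoch q (t * q ^ 2 * w)))"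
    unfolding shift_kernel_minus_1[of a k "- x", unfolded mw] q_def[symmetric] t_def[symmetric] s_def[symmetric] P_def by simp
  also have "\<dots> = q ^ 2 / s ^ 3 * qpoch q (1 / w) * P / (1 / w * (e2 * e3 * V * (d2 * d3 * U)))"
    unfolding p2 using s by simp
  finally have K2: "shift_kernel a k (- x - 1) = C * (q ^ 2 * (w * (1 - 1 / w) * (1 - q / w)) / (d2 * d3 * e2 * e3))"
    unfolding pw C_def by (simp add: mult_ac)
  define E where "E = (1 - w) * (1 - q * w) * (1 - 1 / w) * (1 - q / w)"
  have tq: "qpow a (k + 1) = t * q" by (simp add: qpow_add t_def q_def)
  have D0: "delta a k x = E * P * R / (U * V * (d0 * d1 * d2 * d3 * (e0 * e1 * e2 * e3)))"
    unfolding delta_qpoch[OF a] q_def[symmetric] t_def[symmetric] w_def[symmetric] p0 pw E_def by (simp add: mult_ac)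
  \<comment> \<open>The denominator products of this weight start one factor later, so it is
    \<open>d0 * e0\<close> times \<open>delta a k x\<close>.\<close>
  have "delta a (k + 1) x = E * P * R / (U * V * (d1 * d2 * d3 * (e1 * e2 * e3)))"
    unfolding delta_qpoch[OF a] tq q_def[symmetric] w_def[symmetric] p1 pw E_def by (simp add: mult_ac)
  hence D1: "delta a (k + 1) x = d0 * e0 * delta a k x"
    unfolding D0 using ne by (simp add: mult_ac)
  have g: "g_norm a (k + 1) \<noteq> 0" "g_norm a k \<noteq> 0" using g_norm_nonzero a k by simp_all
  have "g_norm a (k + 2) = g_norm a (k + 1) * ((1 + t * q) * (1 - t ^ 2 * q ^ 3))"
    using g_norm_plus_1[of a "k + 1"] a k
    by (simp add: tq power_mult_distrib eval_nat_numeral add.assoc mult_ac flip: q_def)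
  moreover have "g_norm a (k + 1) = g_norm a k * ((1 + t) * (1 - t ^ 2 * q))"
    using g_norm_plus_1[of a k] a k by (simp add: t_def q_def)
  ultimately have G: "g_norm a (k + 2) / g_norm a (k + 1) = (1 + t * q) * (1 - t ^ 2 * q ^ 3)"
    "g_norm a (k + 2) / g_norm a k = (1 + t) * (1 - t ^ 2 * q) * ((1 + t * q) * (1 - t ^ 2 * q ^ 3))"
    using g by simp_all
  have ts: "qpow a (k + 3/2) = t * s ^ 3" by (simp only: qpow_add t_def s3)
  have rat: "(1 - 1 / w) * (1 - q / w) / (w * (e0 * e1 * e2 * e3)) + w * (1 - w) * (1 - q * w) / (d0 * d1 * d2 * d3)
       - q ^ 2 * ((1 - w) * (1 - q * w) / w + w * (1 - 1 / w) * (1 - q / w)) / (d2 * d3 * e2 * e3)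
     = E * (1 + t * q) * (1 - t ^ 2 * q ^ 3) * ((1 + t) * (1 - t ^ 2 * q) - (1 - t * q) * d0 * e0)
       / (t * (d0 * d1 * d2 * d3 * (e0 * e1 * e2 * e3)))"
    using kernel_rational_identity[of w t q] nz ne
    unfolding E_def d0_def d1_def d2_def d3_def e0_def e1_def e2_def e3_def by blast
  have "shift_kernel a k x + shift_kernel a k (- x) - shift_kernel a k (x - 1) - shift_kernel a k (- x - 1) =
    C * ((1 - 1 / w) * (1 - q / w) / (w * (e0 * e1 * e2 * e3)) + w * (1 - w) * (1 - q * w) / (d0 * d1 * d2 * d3)
       - q ^ 2 * ((1 - w) * (1 - q * w) / w + w * (1 - 1 / w) * (1 - q / w)) / (d2 * d3 * e2 * e3))"
    unfolding K0 K0' K1 K2 by (simp only: add_divide_distrib ring_distribs) simp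
  also have "\<dots> = delta a k x * ((1 + t * q) * (1 - t ^ 2 * q ^ 3) * ((1 + t) * (1 - t ^ 2 * q) - (1 - t * q) * d0 * e0)) / (t * s ^ 3)"
    unfolding rat C_def D0 by (simp add: mult_ac)
  also have "\<dots> = (g_norm a (k + 2) / g_norm a k * delta a k x
             - (1 - qpow a (k + 1)) * (g_norm a (k + 2) / g_norm a (k + 1)) * delta a (k + 1) x) / qpow a (k + 3/2)"
    unfolding D1 G ts tq by (simp add: algebra_simps)
  finally show ?thesis .
qed

section \<open>Moving vertical lines of integration across a strip\<close>

lemma contour_integral_linepath_same_Im:
  assumes "c < d"
  shows "contour_integral (linepath (Complex c y) (Complex d y)) h = integral {c..d} (\<lambda>s. h (Complex s y))"
proof -
  have "linepath (Complex c y) (Complex d y) u = Complex (c + (d - c) * u) y" for u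
    by (simp add: linepath_def complex_eq_iff algebra_simps)
  moreover have "Complex d y - Complex c y = of_real (d - c)"
    by (simp add: complex_eq_iff)
  ultimately have "contour_integral (linepath (Complex c y) (Complex d y)) h =
                     of_real (d - c) * integral {0..1} (\<lambda>u. h (Complex (c + (d - c) * u) y))"
    by (simp add: contour_integral_integral)
  also have "{0..1} = (\<lambda>u. u / (d - c)) ` {c-c..d-c}"
    using assms by simp
  also have "integral \<dots> (\<lambda>u. h (Complex (c + (d - c) * u) y)) =
               integral {c-c..d-c} (\<lambda>u. h (Complex (u + c) y)) / of_real (d - c)"
    using assms by (subst integral_stretch_real) (auto simp: scaleR_conv_of_real add_ac)
  also have "\<dots> = integral {c..d} (\<lambda>s. h (Complex s y)) / of_real (d - c)"
    by (subst integral_shift_real_ivl) (rule refl)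
  finally show ?thesis using assms by simp
qed

text \<open>The two cut-offs vary independently, so each can later be placed at a height where the
  horizontal segment contributes little.\<close>

lemma has_integral_UNIV_truncated:
  fixes F :: "real \<Rightarrow> complex"
  assumes "F integrable_on UNIV" "e > 0"
  obtains B where "B > 0"
    "\<And>y1 y2. y1 \<le> - B \<Longrightarrow> B \<le> y2 \<Longrightarrow> norm (integral {y1..y2} F - integral UNIV F) < e"
proof -
  have "(F has_integral integral UNIV F) UNIV" using assms by blast
  then obtain B where B: "B > 0"
    "\<And>y1 y2. ball 0 B \<subseteq> cbox y1 y2 \<Longrightarrow> norm (integral (cbox y1 y2) F - integral UNIV F) < e"
    using assms(2) unfolding has_integral_alt' by auto
  show thesis
  proof (rule that[OF B(1)])
    fix y1 y2 assume "y1 \<le> - B" "B \<le> y2"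
    hence "ball 0 B \<subseteq> cbox y1 y2" by (auto simp: dist_real_def)
    thus "norm (integral {y1..y2} F - integral UNIV F) < e" using B(2) by simp
  qed
qed

text \<open>Cauchy's theorem for the boundary of a rectangle, applied in the closed strip, which is
  convex.\<close>

lemma strip_rectangle_integral:
  assumes h: "h holomorphic_on {z. Re z \<in> {c..d}}" and "c < d" "y1 < y2"
  shows "\<i> * (integral {y1..y2} (\<lambda>t. h (Complex c t)) - integral {y1..y2} (\<lambda>t. h (Complex d t))) =
           integral {c..d} (\<lambda>s. h (Complex s y1)) - integral {c..d} (\<lambda>s. h (Complex s y2))"
proof -
  define S where "S = {z. Re z \<in> {c..d}}"
  have "convex S"
    unfolding S_def using convex_real_interval(5)[of c d] 
    by (rule convex_linear_vimage[OF bounded_linear.linear[OF bounded_linear_Re], unfolded vimage_def])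
  have cont: "continuous_on S h" using h unfolding S_def by (rule holomorphic_on_imp_continuous_on)
  define A B C D where "A = Complex c y1" and "B = Complex d y1" and "C = Complex d y2" and "D = Complex c y2"
  have in_S: "A \<in> S" "B \<in> S" "C \<in> S" "D \<in> S"
    using assms by (auto simp: S_def A_def B_def C_def D_def)
  have sub: "closed_segment z z' \<subseteq> S" if "z \<in> S" "z' \<in> S" for z z'
    using that \<open>convex S\<close> by (simp add: closed_segment_subset)
  have seg: "continuous_on (closed_segment z z') h" if "z \<in> S" "z' \<in> S" for z z'
    by (rule continuous_on_subset[OF cont sub[OF that]])
  have int: "h contour_integrable_on linepath z z'" if "z \<in> S" "z' \<in> S" for z z'
    by (rule contour_integrable_continuous_linepath[OF seg[OF that]])
  have "(h has_contour_integral 0) (linepath A B +++ linepath B C +++ linepath C D +++ linepath D A)"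
  proof (rule Cauchy_theorem_convex_simple)
    show "h holomorphic_on S" using h by (simp add: S_def)
    show "path_image (linepath A B +++ linepath B C +++ linepath C D +++ linepath D A) \<subseteq> S"
      using sub in_S by (simp add: path_image_join)
  qed (simp_all add: \<open>convex S\<close>)
  note Cauchy = contour_integral_unique[OF this]
  have "contour_integral (linepath A B) h + contour_integral (linepath B C) h
       + contour_integral (linepath C D) h + contour_integral (linepath D A) h = 0"
    using Cauchy int in_S by (simp add: add.assoc)
  moreover have "contour_integral (linepath C D) h = - contour_integral (linepath D C) h"
    "contour_integral (linepath D A) h = - contour_integral (linepath A D) h"
    by (rule contour_integral_reverse_linepath, rule seg; rule in_S)+
  moreover have "contour_integral (linepath B C) h = \<i> * integral {y1..y2} (\<lambda>t. h (Complex d t))"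
    "contour_integral (linepath A D) h = \<i> * integral {y1..y2} (\<lambda>t. h (Complex c t))"
    using \<open>y1 < y2\<close> by (auto simp: A_def B_def C_def D_def intro!: contour_integral_linepath_same_Re)
  moreover have "contour_integral (linepath A B) h = integral {c..d} (\<lambda>s. h (Complex s y1))"
    "contour_integral (linepath D C) h = integral {c..d} (\<lambda>s. h (Complex s y2))"
    unfolding A_def B_def C_def D_def using \<open>c < d\<close> by (auto intro!: contour_integral_linepath_same_Im)
  ultimately show ?thesis by (simp add: algebra_simps)
qed

lemma norm_integral_mult_bounded_le:
  fixes K f :: "real \<Rightarrow> complex"
  assumes "continuous_on {c..d} f" "continuous_on {c..d} K" "\<And>s. s \<in> {c..d} \<Longrightarrow> norm (K s) \<le> M"
  shows "norm (integral {c..d} (\<lambda>s. K s * f s)) \<le> M * integral {c..d} (\<lambda>s. norm (f s))"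
proof -
  have "norm (integral {c..d} (\<lambda>s. K s * f s)) \<le> integral {c..d} (\<lambda>s. M * norm (f s))"
    using assms by (intro integral_norm_bound_integral integrable_continuous_interval continuous_intros)
                   (auto simp: norm_mult intro!: mult_right_mono)
  thus ?thesis by simp
qed

text \<open>By Cauchy's theorem for the product of K and f, the error consists of the two horizontal
  sides, where K is bounded by M. Their integrals of |f| are enlarged from [-1,0] to [-1,1], the
  form in which admissibility controls them.\<close>

lemma norm_strip_shift_le:
  assumes f: "f holomorphic_on {z. Re z \<in> {-1..1}}"
    and K: "K holomorphic_on {z. Re z \<in> {-1..0}}" 
    and M: "\<And>z. Re z \<in> {-1..0} \<Longrightarrow> norm (K z) \<le> M" and y: "y1 < y2"
  shows "norm (integral {y1..y2} (\<lambda>t. K (Complex (-1) t) * f (Complex (-1) t))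
             - integral {y1..y2} (\<lambda>t. K (Complex 0 t) * f (Complex 0 t)))
         \<le> M * (integral {-1..1} (\<lambda>s. norm (f (Complex s y1))) + integral {-1..1} (\<lambda>s. norm (f (Complex s y2))))"
proof -
  have fc: "continuous_on {-1..1} (\<lambda>s. f (Complex s y))" for y
    by (rule continuous_on_compose2[OF holomorphic_on_imp_continuous_on[OF f]])
       (auto simp: Complex_eq intro!: continuous_intros)
  have Kc: "continuous_on {-1..0} (\<lambda>s. K (Complex s y))" for y
    by (rule continuous_on_compose2[OF holomorphic_on_imp_continuous_on[OF K]])
       (auto simp: Complex_eq intro!: continuous_intros)
  have "M \<ge> 0" using M[of 0] norm_ge_zero[of "K 0"] by (simp del: norm_ge_zero) 
  have horizontal: "norm (integral {-1..0} (\<lambda>s. K (Complex s y) * f (Complex s y)))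
                    \<le> M * integral {-1..1} (\<lambda>s. norm (f (Complex s y)))" for y
  proof -
    have fc': "continuous_on {-1..0} (\<lambda>s. f (Complex s y))"
      by (rule continuous_on_subset[OF fc]) auto
    have "norm (integral {-1..0} (\<lambda>s. K (Complex s y) * f (Complex s y)))
           \<le> M * integral {-1..0} (\<lambda>s. norm (f (Complex s y)))"
      using M by (intro norm_integral_mult_bounded_le fc' Kc) auto
    also have "\<dots> \<le> M * integral {-1..1} (\<lambda>s. norm (f (Complex s y)))"
      using \<open>M \<ge> 0\<close> fc fc' 
      by (intro mult_left_mono integral_subset_le integrable_continuous_interval continuous_intros) auto
    finally show ?thesis .
  qed
  have "(\<lambda>z. K z * f z) holomorphic_on {z. Re z \<in> {-1..0}}"
    by (intro holomorphic_intros K holomorphic_on_subset[OF f]) auto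
  from strip_rectangle_integral[OF this _ y]
  have "norm (\<i> * (integral {y1..y2} (\<lambda>t. K (Complex (-1) t) * f (Complex (-1) t))
             - integral {y1..y2} (\<lambda>t. K (Complex 0 t) * f (Complex 0 t))))
        = norm (integral {-1..0} (\<lambda>s. K (Complex s y1) * f (Complex s y1))
              - integral {-1..0} (\<lambda>s. K (Complex s y2) * f (Complex s y2)))" by simp
  also have "\<dots> \<le> M * integral {-1..1} (\<lambda>s. norm (f (Complex s y1))) + M * integral {-1..1} (\<lambda>s. norm (f (Complex s y2)))"
    using horizontal by (intro order.trans[OF norm_triangle_ineq4] add_mono)
  finally show ?thesis by (simp only: norm_mult norm_ii mult_1 distrib_left)
qed

section \<open>The identity for truncated integrals, and passage to the limit\<close>

text \<open>Adding and subtracting \<open>K x * f x\<close> and \<open>K (- x) * f x\<close> splits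
  the integrand into two contour-shift differences and a multiple of \<open>f x\<close> given by the
  coefficient identity. Each difference contributes once to the factor 2 in the bound.\<close>

lemma truncated_shift_identity_le:
  assumes a: "a > 0" and k: "Re k > 0" and f: "f holomorphic_on {z. Re z \<in> {-1..1}}"
    and M: "\<And>z. Re z \<in> {-1..0} \<Longrightarrow> norm (shift_kernel a k z) \<le> M" and y: "y1 < y2"
    and F0: "Psi_defined a k f" and F1: "Psi_defined a (k + 1) f"
  defines "c0 \<equiv> g_norm a (k + 2) / g_norm a k / qpow a (k + 3/2)"
    and "c1 \<equiv> (1 - qpow a (k + 1)) * (g_norm a (k + 2) / g_norm a (k + 1)) / qpow a (k + 3/2)"
  shows "norm (integral {y1..y2} (\<lambda>t. shift_op a (shift_op a f) (\<i> * of_real t) * delta a (k + 2) (\<i> * of_real t))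
           - (c0 * integral {y1..y2} (\<lambda>t. f (\<i> * of_real t) * delta a k (\<i> * of_real t))
              - c1 * integral {y1..y2} (\<lambda>t. f (\<i> * of_real t) * delta a (k + 1) (\<i> * of_real t))))
         \<le> 2 * M * (integral {-1..1} (\<lambda>s. norm (f (Complex s y1))) + integral {-1..1} (\<lambda>s. norm (f (Complex s y2))))"
proof -
  define K where "K = shift_kernel a k"
  \<comment> \<open>Reflection turns \<open>f (x + 1)\<close> into \<open>h (- x - 1)\<close>, so
    the shift to the right also becomes one across the strip on the left, where K is
    holomorphic.\<close>
  define h where "h = (\<lambda>z. f (- z))"
  define D where "D = (\<lambda>g t. K (Complex (-1) t) * g (Complex (-1) t) - K (Complex 0 t) * g (Complex 0 t))"
  define F where "F = (\<lambda>j t. f (\<i> * of_real t) * delta a (k + of_nat j) (\<i> * of_real t))"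
  define H where "H = (\<lambda>y. integral {-1..1} (\<lambda>s. norm (f (Complex s y))))"
  have K: "K holomorphic_on {z. Re z \<in> {-1..0}}" 
    unfolding K_def using a k by (rule holomorphic_shift_kernel)
  have h: "h holomorphic_on {z. Re z \<in> {-1..1}}"
  proof -
    have "(f \<circ> uminus) holomorphic_on {z. Re z \<in> {-1..1}}"
      by (rule holomorphic_on_compose_gen[OF _ f]) (auto intro!: holomorphic_intros)
    thus ?thesis by (simp add: h_def o_def)
  qed
  have vertical: "continuous_on A (\<lambda>t. g (Complex c t))" 
    if "g holomorphic_on {z. Re z \<in> {b..d}}" "c \<in> {b..d}" for g A b c d
    by (rule continuous_on_compose2[OF holomorphic_on_imp_continuous_on[OF that(1)]])
       (use that(2) in \<open>auto simp: Complex_eq intro!: continuous_intros\<close>)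
  have D_cont: "continuous_on A (D g)" if "g holomorphic_on {z. Re z \<in> {-1..1}}" for g A
    unfolding D_def by (intro continuous_intros vertical[OF K] vertical[OF that]) auto
  have D_int: "D g integrable_on {u..v}" if "g holomorphic_on {z. Re z \<in> {-1..1}}" for g u v
    by (rule integrable_continuous_interval[OF D_cont[OF that]])
  have D_le: "norm (integral {u..v} (D g)) \<le> M * (integral {-1..1} (\<lambda>s. norm (g (Complex s u))) + integral {-1..1} (\<lambda>s. norm (g (Complex s v))))"
    if g: "g holomorphic_on {z. Re z \<in> {-1..1}}" and "u < v" for g u v
  proof -
    have "integral {u..v} (D g) = integral {u..v} (\<lambda>t. K (Complex (-1) t) * g (Complex (-1) t)) - integral {u..v} (\<lambda>t. K (Complex 0 t) * g (Complex 0 t))"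
      unfolding D_def
      by (intro Henstock_Kurzweil_Integration.integral_diff integrable_continuous_interval 
            continuous_intros vertical[OF K] vertical[OF g]) auto
    thus ?thesis using norm_strip_shift_le[OF g K _ that(2), of M] M by (simp add: K_def)
  qed
  have pointwise: "shift_op a (shift_op a f) (\<i> * of_real t) * delta a (k + 2) (\<i> * of_real t)
          = D f t + D h (- t) + (c0 * F 0 t - c1 * F 1 t)" for t
  proof -
    define x where "x = \<i> * complex_of_real t"
    have x: "Re x = 0" by (simp add: x_def)
    have C: "Complex (-1) t = x - 1" "Complex 0 t = x" "Complex (-1) (- t) = - x - 1" "Complex 0 (- t) = - x"
      by (simp_all add: x_def complex_eq_iff)
    have "D f t + D h (- t) + (K x + K (- x) - K (x - 1) - K (- x - 1)) * f x
        = K (x - 1) * (f (x - 1) - f x) + K (- x - 1) * (f (x + 1) - f x)"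
      by (simp add: D_def C h_def algebra_simps)
    moreover have "(K x + K (- x) - K (x - 1) - K (- x - 1)) * f x = c0 * F 0 t - c1 * F 1 t"
      unfolding K_def shift_kernel_identity[OF a k x] c0_def c1_def F_def x_def[symmetric]
      by (simp add: add_divide_distrib diff_divide_distrib algebra_simps)
    ultimately show ?thesis
      using shift_op_delta[OF a k x, of f] by (simp add: x_def K_def)
  qed
  have F_int: "F 0 integrable_on {y1..y2}" "F 1 integrable_on {y1..y2}"
    using F0 F1 integrable_on_subinterval[OF _ subset_UNIV]
    unfolding Psi_defined_def imag_line_integrable_def F_def by simp_all
  have Dh_int: "(\<lambda>t. D h (- t)) integrable_on {y1..y2}"
    using D_int[OF h, of "- y2" "- y1"] Henstock_Kurzweil_Integration.integrable_reflect_real[where f = "D h" and a = "- y2" and b = "- y1"] by simp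
  have "integral {y1..y2} (\<lambda>t. shift_op a (shift_op a f) (\<i> * of_real t) * delta a (k + 2) (\<i> * of_real t))
      = integral {y1..y2} (D f) + integral {y1..y2} (\<lambda>t. D h (- t)) + (c0 * integral {y1..y2} (F 0) - c1 * integral {y1..y2} (F 1))"
    unfolding pointwise using F_int D_int[OF f] Dh_int
    by (simp add: Henstock_Kurzweil_Integration.integral_add Henstock_Kurzweil_Integration.integral_diff
           integrable_add integrable_diff integrable_on_mult_right)
  moreover have "integral {y1..y2} (\<lambda>t. D h (- t)) = integral {- y2..- y1} (D h)"
    using Henstock_Kurzweil_Integration.integral_reflect_real[where f = "D h" and a = "- y2" and b = "- y1"] by simp
  ultimately have "norm (integral {y1..y2} (\<lambda>t. shift_op a (shift_op a f) (\<i> * of_real t) * delta a (k + 2) (\<i> * of_real t))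
      - (c0 * integral {y1..y2} (F 0) - c1 * integral {y1..y2} (F 1)))
      \<le> norm (integral {y1..y2} (D f)) + norm (integral {- y2..- y1} (D h))"
    using norm_triangle_ineq by simp
  also have "\<dots> \<le> M * (H y1 + H y2) + M * (H y2 + H y1)"
  proof (intro add_mono)
    show "norm (integral {y1..y2} (D f)) \<le> M * (H y1 + H y2)"
      using D_le[OF f y] by (simp add: H_def)
    \<comment> \<open>The interval [-1,1] is symmetric, so reflecting f leaves the horizontal
      integrals unchanged up to the sign of the height.\<close>
    have "integral {-1..1} (\<lambda>s. norm (h (Complex s (- y)))) = H y" for y
    proof -
      have "h (Complex s (- y)) = f (Complex (- s) y)" for s
        unfolding h_def by (rule arg_cong[of _ _ f]) (simp add: complex_eq_iff)
      thus ?thesis unfolding H_def 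
        using Henstock_Kurzweil_Integration.integral_reflect_real[where f = "\<lambda>s. norm (f (Complex s y))" and a = "-1" and b = 1] by simp
    qed
    thus "norm (integral {- y2..- y1} (D h)) \<le> M * (H y2 + H y1)"
      using D_le[OF h, of "- y2" "- y1"] y by simp
  qed
  finally show ?thesis by (simp add: F_def H_def algebra_simps)
qed

theorem theorem2p7:
  fixes a :: real and k :: complex and f :: "complex \<Rightarrow> complex"
  assumes "a > 0" and "Re k > 0"
    and "f analytic_on {x. \<bar>Re x\<bar> \<le> 1}"
    and "Psi_defined a k f"
    and "Psi_defined a (k + 1) f"
    and "Psi_defined a (k + 2) (shift_op a (shift_op a f))"
    and "contour_shift_admissible f"
  shows "Psi a k f = (1 - qpow a (k + 1)) * Psi a (k + 1) f
           + qpow a (k + 3/2) * Psi a (k + 2) (shift_op a (shift_op a f))"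
proof -
  define G where "G = (\<lambda>j t. (if j = 2 then shift_op a (shift_op a f) else f) (\<i> * complex_of_real t)
                          * delta a (k + of_nat j) (\<i> * complex_of_real t))"
  define J where "J = (\<lambda>j. integral UNIV (G j))"
  define \<kappa> where "\<kappa> = qpow a (k + 3/2)"
  define c0 where "c0 = g_norm a (k + 2) / g_norm a k / \<kappa>"
  define c1 where "c1 = (1 - qpow a (k + 1)) * (g_norm a (k + 2) / g_norm a (k + 1)) / \<kappa>"
  define H where "H = (\<lambda>y. integral {-1..1} (\<lambda>s. norm (f (Complex s y))))"
  obtain M where M: "M > 0" "\<And>z. Re z \<in> {-1..0} \<Longrightarrow> norm (shift_kernel a k z) \<le> M"
    using bounded_shift_kernel[OF assms(1,2)] by blast
  have f: "f holomorphic_on {z. Re z \<in> {-1..1}}"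
    by (rule holomorphic_on_subset[OF analytic_imp_holomorphic[OF assms(3)]]) auto
  have G_int: "G 0 integrable_on UNIV" "G 1 integrable_on UNIV" "G 2 integrable_on UNIV"
    using assms(4-6) unfolding Psi_defined_def imag_line_integrable_def G_def by simp_all
  \<comment> \<open>The 1 and the norms of \<open>c0\<close> and \<open>c1\<close> account for
    truncating the three integrals, and \<open>4 * M\<close> for the horizontal segments at both
    ends.\<close>
  define C where "C = 1 + norm c0 + norm c1 + 4 * M"
  have "norm (J 2 - (c0 * J 0 - c1 * J 1)) \<le> C * e" if "e > 0" for e
  proof -
    have trunc: "\<exists>B>0. \<forall>y1 y2. y1 \<le> - B \<longrightarrow> B \<le> y2 \<longrightarrow> norm (integral {y1..y2} (G j) - J j) < e" 
      if "G j integrable_on UNIV" for j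
      using has_integral_UNIV_truncated[OF that \<open>e > 0\<close>] unfolding J_def by metis
    obtain B0 B1 B2 where B: "B0 > 0" 
      "\<And>y1 y2. y1 \<le> - B0 \<Longrightarrow> B0 \<le> y2 \<Longrightarrow> norm (integral {y1..y2} (G 0) - J 0) < e"
      "\<And>y1 y2. y1 \<le> - B1 \<Longrightarrow> B1 \<le> y2 \<Longrightarrow> norm (integral {y1..y2} (G 1) - J 1) < e"
      "\<And>y1 y2. y1 \<le> - B2 \<Longrightarrow> B2 \<le> y2 \<Longrightarrow> norm (integral {y1..y2} (G 2) - J 2) < e"
      using trunc[OF G_int(1)] trunc[OF G_int(2)] trunc[OF G_int(3)] by blast
    define B where "B = max B0 (max B1 B2)"
    have freq: "\<exists>\<^sub>F y in at_top. H y < e" "\<exists>\<^sub>F y in at_bot. H y < e"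
      using assms(7) \<open>e > 0\<close> unfolding contour_shift_admissible_def H_def by auto
    \<comment> \<open>Small horizontal integrals occur at arbitrarily large heights, hence also
      beyond the threshold B in both directions.\<close>
    obtain y1 y2 where y: "y1 \<le> - B" "H y1 < e" "y2 \<ge> B" "H y2 < e"
      using frequently_ex[OF frequently_eventually_conj[OF freq(1) eventually_ge_at_top[of B]]]
        frequently_ex[OF frequently_eventually_conj[OF freq(2) eventually_le_at_bot[of "- B"]]] by blast
    define I where "I = (\<lambda>j. integral {y1..y2} (G j))"
    have I: "norm (I 0 - J 0) \<le> e" "norm (I 1 - J 1) \<le> e" "norm (J 2 - I 2) \<le> e"
      using B(2-4)[of y1 y2] y by (auto simp: B_def I_def norm_minus_commute intro!: less_imp_le)
    have "B > 0" using B(1) by (simp add: B_def)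
    hence "norm (I 2 - (c0 * I 0 - c1 * I 1)) \<le> 2 * M * (H y1 + H y2)"
      using truncated_shift_identity_le[OF assms(1,2) f M(2) _ assms(4,5), of y1 y2] y
      by (simp add: I_def G_def H_def c0_def c1_def \<kappa>_def)
    also have "\<dots> \<le> 2 * M * (e + e)"
      using M y by (intro mult_left_mono add_mono) auto
    finally have II: "norm (I 2 - (c0 * I 0 - c1 * I 1)) \<le> 4 * M * e" by simp
    have "J 2 - (c0 * J 0 - c1 * J 1) = (J 2 - I 2) + (c0 * (I 0 - J 0) + (- c1 * (I 1 - J 1) + (I 2 - (c0 * I 0 - c1 * I 1))))"
      by (simp add: algebra_simps)
    also have "norm \<dots> \<le> e + (norm c0 * e + (norm c1 * e + 4 * M * e))"
      using I II by (intro norm_triangle_mono) (auto simp: norm_mult intro!: mult_left_mono)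
    finally show ?thesis by (simp add: C_def algebra_simps)
  qed
  moreover have "C > 0" using M by (simp add: C_def add_pos_nonneg add_nonneg_pos)
  \<comment> \<open>The bound is applied with e divided by C.\<close>
  ultimately have "norm (J 2 - (c0 * J 0 - c1 * J 1)) \<le> 0 + e" if "e > 0" for e
    using that by (metis add_0 divide_pos_pos less_irrefl nonzero_eq_divide_eq mult.commute)
  hence "norm (J 2 - (c0 * J 0 - c1 * J 1)) \<le> 0" by (rule field_le_epsilon)
  hence J: "J 2 = c0 * J 0 - c1 * J 1" by simp
  have g: "g_norm a k \<noteq> 0" "g_norm a (k + 1) \<noteq> 0" "g_norm a (k + 2) \<noteq> 0"
    using assms(1,2) by (simp_all add: g_norm_nonzero)
  have "\<kappa> \<noteq> 0" by (simp add: \<kappa>_def)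
  \<comment> \<open>The factor i from parametrising the line cancels the one in the
    normalisation.\<close>
  have Psi: "Psi a k f = J 0 / g_norm a k" "Psi a (k + 1) f = J 1 / g_norm a (k + 1)"
    "Psi a (k + 2) (shift_op a (shift_op a f)) = J 2 / g_norm a (k + 2)"
    by (simp_all add: Psi_def imag_line_integral_def J_def G_def)
  have "\<kappa> * (J 2 / g_norm a (k + 2)) = J 0 / g_norm a k - (1 - qpow a (k + 1)) * (J 1 / g_norm a (k + 1))"
    unfolding J c0_def c1_def using g \<open>\<kappa> \<noteq> 0\<close> by (simp add: field_simps)
  thus ?thesis unfolding Psi \<kappa>_def[symmetric] by simp
qed

end
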